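(* Let $\mathcal{H}$ be a Hilbert space of finite dimension $d\ge2$, and let $\mathbf{U}=\{U_x:x\in X\}$ and $\mathbf{U}'=\{U'_x:x\in X\}$ be unitary bases for $\mathcal{H}$. Then the following are equivalent. (i) $\mathbf{U}$ is equivalent to $\mathbf{U}'$. (ii) For some $\mathbf{U}$-associated tag $\mathbf{T}=(x_0,U_{x_0},\mathbf{W})$ and some $\mathbf{U}'$-associated tag $\mathbf{T}'=(x_0',U'_{x_0'},\mathbf{W}')$, $\mathbf{W}$ is collectively unitarily equivalent to $\mathbf{W}'$. (iii) For each $\mathbf{U}$-associated tag $\mathbf{T}=(x_0,U_{x_0},\mathbf{W})$ there is a $\mathbf{U}'$-associated tag $\mathbf{T}'=(x_0',U'_{x_0'},\mathbf{W}')$ such that $\mathbf{W}$ is collectively unitarily equivalent to $\mathbf{W}'$.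
   Context: $X$ is a set with $d^2$ elements. A unitary basis for $\mathcal{H}$ is a family $\mathbf{U}=\{U_x:x\in X\}$ of unitary operators on $\mathcal{H}$ with $\mathrm{tr}(U_x^*U_y)=d\,\delta_{xy}$ for $x,y\in X$. Two unitary bases $\mathbf{U},\mathbf{U}'$ are equivalent if there exist unitaries $V_1,V_2$ on $\mathcal{H}$ and a bijection $x\mapsto x'$ of $X$ with $U'_{x'}=V_1U_xV_2$ for all $x\in X$. For a unitary basis $\mathbf{U}$ and $x_0\in X$, the $\mathbf{U}$-associated tag at $x_0$ is the triple $(x_0,U_{x_0},\mathbf{W})$ with $\mathbf{W}=\{W_x=U_{x_0}^*U_x:x\in X,\ x\ne x_0\}$. Subsets $\mathcal{F},\mathcal{G}$ of $\mathcal{B}(\mathcal{H})$ are collectively unitarily equivalent (via $V$) if there is a unitary $V$ on $\mathcal{H}$ with $\mathcal{G}=\{V^*AV:A\in\mathcal{F}\}$. *)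

theory Defs
  imports "HOL-Analysis.Finite_Cartesian_Product"
begin

(* The inner product is conjugate-linear in its first and linear in its second argument.
   Completeness is not an axiom: it is automatic in finite dimension. *)
class findim_hilbert = ab_group_add +
  fixes scaleC :: "complex \<Rightarrow> 'a \<Rightarrow> 'a" (infixr "*\<^sub>C" 75)
    and cinner :: "'a \<Rightarrow> 'a \<Rightarrow> complex"
  assumes scaleC_add_right: "c *\<^sub>C (x + y) = c *\<^sub>C x + c *\<^sub>C y"
    and scaleC_add_left: "(b + c) *\<^sub>C x = b *\<^sub>C x + c *\<^sub>C x"
    and scaleC_scaleC: "b *\<^sub>C c *\<^sub>C x = (b * c) *\<^sub>C x"
    and scaleC_one: "1 *\<^sub>C x = x"
    and cinner_commute: "cinner x y = cnj (cinner y x)"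
    and cinner_add_right: "cinner x (y + z) = cinner x y + cinner x z"
    and cinner_scaleC_right: "cinner x (c *\<^sub>C y) = c * cinner x y"
    and cinner_pos: "x \<noteq> 0 \<Longrightarrow> 0 < Re (cinner x x)"
    and ex_finite_spanning: "\<exists>B. finite B \<and> (\<forall>x. \<exists>c. x = (\<Sum>b\<in>B. c b *\<^sub>C b))"

global_interpretation complex_vector:
  vector_space "scaleC :: complex \<Rightarrow> 'h \<Rightarrow> 'h::findim_hilbert"
  by unfold_locales
    (simp_all add: scaleC_add_right scaleC_add_left scaleC_scaleC scaleC_one)

abbreviation clinear :: "('h::findim_hilbert \<Rightarrow> 'h) \<Rightarrow> bool"
  where "clinear \<equiv> Vector_Spaces.linear scaleC scaleC"

lemma cinner_add_left: "cinner (x + y) z = cinner x z + cinner y (z::'h::findim_hilbert)"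
  by (metis cinner_add_right cinner_commute complex_cnj_add)

lemma cinner_scaleC_left: "cinner (c *\<^sub>C x) y = cnj c * cinner x (y::'h::findim_hilbert)"
  by (metis cinner_scaleC_right cinner_commute complex_cnj_mult)

lemma cinner_zero_right [simp]: "cinner x (0::'h::findim_hilbert) = 0"
  using cinner_add_right[of x 0 0] by simp

lemma cinner_zero_left [simp]: "cinner (0::'h::findim_hilbert) x = 0"
  using cinner_add_left[of 0 0 x] by simp

lemma cinner_diff_right: "cinner x (y - z) = cinner x y - cinner x (z::'h::findim_hilbert)"
  using cinner_add_right[of x "y - z" z] by simp

lemma cinner_diff_left: "cinner (x - y) z = cinner x z - cinner y (z::'h::findim_hilbert)"
  using cinner_add_left[of "x - y" y z] by simp

lemma cinner_eq_zero_iff [simp]: "cinner x x = 0 \<longleftrightarrow> x = (0::'h::findim_hilbert)"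
  using cinner_pos[of x] by force

lemma cinner_ext:
  fixes x y :: "'h::findim_hilbert"
  assumes "\<And>z. cinner z x = cinner z y"
  shows "x = y"
proof -
  have "cinner (x - y) (x - y) = 0"
    using assms by (simp add: cinner_diff_right)
  then show ?thesis by simp
qed

lemma cinner_sum_right:
  "cinner x (\<Sum>i\<in>I. f i) = (\<Sum>i\<in>I. cinner x (f i :: 'h::findim_hilbert))"
  by (induction I rule: infinite_finite_induct) (simp_all add: cinner_add_right)

lemma ex_finite_span:
  "\<exists>B :: 'h::findim_hilbert set. finite B \<and> complex_vector.span B = UNIV"
proof -
  obtain B :: "'h set" where B: "finite B" "\<And>x. \<exists>c. x = (\<Sum>b\<in>B. c b *\<^sub>C b)"
    using ex_finite_spanning by blast
  have "x \<in> complex_vector.span B" for x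
  proof -
    obtain c where "x = (\<Sum>b\<in>B. c b *\<^sub>C b)" using B(2) by blast
    then show ?thesis
      by (simp add: complex_vector.span_sum complex_vector.span_scale complex_vector.span_base)
  qed
  with B(1) show ?thesis by blast
qed

lemma finite_if_independent:
  "complex_vector.independent (B :: 'h::findim_hilbert set) \<Longrightarrow> finite B"
  using ex_finite_span complex_vector.independent_span_bound by blast

lemma riesz_representation_span:
  fixes f :: "'h::findim_hilbert \<Rightarrow> complex"
  assumes "finite B"
    and "\<And>x y. f (x + y) = f x + f y" and "\<And>c x. f (c *\<^sub>C x) = c * f x"
  shows "\<exists>y\<in>complex_vector.span B. \<forall>b\<in>complex_vector.span B. cinner y b = f b"
proof -
  have ext: "cinner y b = g b"
    if b: "b \<in> complex_vector.span B" and eq: "\<forall>b\<in>B. cinner y b = g b"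
      and add: "\<And>x y. g (x + y) = g x + g y" and scale: "\<And>c x. g (c *\<^sub>C x) = c * g x"
    for B y b and g :: "'h \<Rightarrow> complex"
    using b
  proof (induction rule: complex_vector.span_induct_alt)
    case base
    show ?case using add[of 0 0] by simp
  next
    case (step c x y)
    then show ?case using eq by (simp add: add scale cinner_add_right cinner_scaleC_right)
  qed
  have "\<exists>y\<in>complex_vector.span B. \<forall>b\<in>B. cinner y b = f b"
    using assms
  proof (induction B arbitrary: f rule: finite_induct)
    case empty
    show ?case by auto
  next
    case (insert b B)
    obtain y where y: "y \<in> complex_vector.span B" "\<forall>c\<in>B. cinner y c = f c"
      using insert.IH[of f] insert.prems by blast
    obtain p where p: "p \<in> complex_vector.span B" "\<forall>c\<in>B. cinner p c = cinner b c"
      using insert.IH[of "cinner b"] by (auto simp: cinner_add_right cinner_scaleC_right)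
    define w where "w = b - p"
    have wB: "cinner w c = 0" if "c \<in> B" for c
      using p(2) that by (simp add: w_def cinner_diff_left)
    have wS: "cinner w c = 0" if "c \<in> complex_vector.span B" for c
      using ext[of c B w "\<lambda>_. 0"] that wB by simp
    have sub: "complex_vector.span B \<subseteq> complex_vector.span (insert b B)"
      by (rule complex_vector.span_mono) auto
    show ?case
    proof (cases "w = 0")
      case True
      then have "b \<in> complex_vector.span B" using p(1) by (simp add: w_def)
      then have "cinner y b = f b" using ext[of b B y f] y(2) insert.prems by blast
      then show ?thesis using y sub by blast
    next
      case False
      define a where "a = cnj ((f b - cinner y b) / cinner w w)"
      have "cinner w b = cinner w w"
        using wS[OF p(1)] by (simp add: w_def cinner_diff_right)
      then have "cinner (y + a *\<^sub>C w) b = f b"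
        using False by (simp add: a_def cinner_add_left cinner_scaleC_left)
      moreover have "cinner (y + a *\<^sub>C w) c = f c" if "c \<in> B" for c
        using y(2) wB that by (simp add: cinner_add_left cinner_scaleC_left)
      moreover have "y + a *\<^sub>C w \<in> complex_vector.span (insert b B)"
        unfolding w_def using y(1) p(1) sub
        by (intro complex_vector.span_add complex_vector.span_scale complex_vector.span_diff)
          (auto intro: complex_vector.span_base)
      ultimately show ?thesis by blast
    qed
  qed
  then show ?thesis using ext assms(2,3) by blast
qed

lemma riesz_representation:
  fixes f :: "'h::findim_hilbert \<Rightarrow> complex"
  assumes "\<And>x y. f (x + y) = f x + f y" and "\<And>c x. f (c *\<^sub>C x) = c * f x"
  shows "\<exists>y. \<forall>x. cinner y x = f x"
proof -
  obtain B :: "'h set" where "finite B" "complex_vector.span B = UNIV"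
    using ex_finite_span by blast
  then show ?thesis using riesz_representation_span[of B f] assms by auto
qed

instantiation complex :: findim_hilbert
begin

definition "(c::complex) *\<^sub>C z = c * z"

definition "cinner (w::complex) z = cnj w * z"

instance
proof
  fix x :: complex
  show "0 < Re (cinner x x)" if "x \<noteq> 0"
    using that by (auto simp: cinner_complex_def complex_eq_iff sum_squares_gt_zero_iff)
  show "\<exists>B. finite B \<and> (\<forall>x::complex. \<exists>c. x = (\<Sum>b\<in>B. c b *\<^sub>C b))"
    by (intro exI[of _ "{1}"]) (auto simp: scaleC_complex_def)
qed (simp_all add: scaleC_complex_def cinner_complex_def algebra_simps)

end

(* In particular, complex ^ 'n is an instance. *)
instantiation vec :: (findim_hilbert, finite) findim_hilbert
begin

definition "c *\<^sub>C v = (\<chi> i. c *\<^sub>C (v $ i))"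

definition "cinner v w = (\<Sum>i\<in>UNIV. cinner (v $ i) (w $ i))"

instance
proof
  fix b c :: complex and x y z :: "'a ^ 'b"
  show add_r: "c *\<^sub>C (x + y) = c *\<^sub>C x + c *\<^sub>C y" for c and x y :: "'a ^ 'b"
    by (simp add: scaleC_vec_def vec_eq_iff scaleC_add_right)
  show add_l: "(b + c) *\<^sub>C x = b *\<^sub>C x + c *\<^sub>C x" for b c and x :: "'a ^ 'b"
    by (simp add: scaleC_vec_def vec_eq_iff scaleC_add_left)
  show assoc: "b *\<^sub>C c *\<^sub>C x = (b * c) *\<^sub>C x" for b c and x :: "'a ^ 'b"
    by (simp add: scaleC_vec_def vec_eq_iff scaleC_scaleC)
  show one: "1 *\<^sub>C x = x" for x :: "'a ^ 'b"
    by (simp add: scaleC_vec_def vec_eq_iff scaleC_one)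
  show "cinner x y = cnj (cinner y x)"
    unfolding cinner_vec_def cnj_sum by (intro sum.cong refl cinner_commute)
  show "cinner x (y + z) = cinner x y + cinner x z"
    by (simp add: cinner_vec_def cinner_add_right sum.distrib)
  show "cinner x (c *\<^sub>C y) = c * cinner x y"
    by (simp add: cinner_vec_def scaleC_vec_def cinner_scaleC_right sum_distrib_left)
  show "0 < Re (cinner x x)" if nz: "x \<noteq> 0"
  proof -
    obtain i where i: "x $ i \<noteq> 0" using nz by (auto simp: vec_eq_iff)
    have nonneg: "0 \<le> Re (cinner v v)" for v :: 'a
      using cinner_pos[of v] by (cases "v = 0") auto
    have "0 < (\<Sum>i\<in>UNIV. Re (cinner (x $ i) (x $ i)))"
      by (rule sum_pos2[of _ i]) (use i nonneg cinner_pos in auto)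
    then show ?thesis by (simp add: cinner_vec_def)
  qed
  show "\<exists>B. finite B \<and> (\<forall>x :: 'a ^ 'b. \<exists>c. x = (\<Sum>b\<in>B. c b *\<^sub>C b))"
  proof -
    interpret V: vector_space "scaleC :: complex \<Rightarrow> 'a ^ 'b \<Rightarrow> 'a ^ 'b"
      by unfold_locales (rule add_r add_l assoc one)+
    obtain B :: "'a set" where B: "finite B" "\<And>x. \<exists>c. x = (\<Sum>b\<in>B. c b *\<^sub>C b)"
      using ex_finite_spanning by blast
    define S where "S = (\<lambda>(i, b). axis i b :: 'a ^ 'b) ` (UNIV \<times> B)"
    have "x \<in> V.span S" for x
    proof -
      have "\<exists>c. \<forall>i. x $ i = (\<Sum>b\<in>B. c i b *\<^sub>C b)"
        by (intro choice allI B(2))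
      then obtain c where c: "\<And>i. x $ i = (\<Sum>b\<in>B. c i b *\<^sub>C b)" by blast
      have "(\<Sum>i\<in>UNIV. \<Sum>b\<in>B. c i b *\<^sub>C axis i b) $ j = x $ j" for j
      proof -
        have "(\<Sum>i\<in>UNIV. \<Sum>b\<in>B. c i b *\<^sub>C axis i b) $ j =
            (\<Sum>i\<in>UNIV. if i = j then \<Sum>b\<in>B. c i b *\<^sub>C b else 0)"
          unfolding sum_component
          by (intro sum.cong refl)
            (simp add: scaleC_vec_def axis_def complex_vector.scale_zero_right)
        then show ?thesis by (simp add: c)
      qed
      then have "x = (\<Sum>i\<in>UNIV. \<Sum>b\<in>B. c i b *\<^sub>C axis i b)"
        by (simp add: vec_eq_iff)
      also have "\<dots> \<in> V.span S"
        by (intro V.span_sum V.span_scale V.span_base) (auto simp: S_def)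
      finally show ?thesis .
    qed
    moreover have "finite S" using B(1) by (simp add: S_def)
    ultimately show ?thesis
      using V.span_finite[of S] by blast
  qed
qed

end

definition cadjoint :: "('h::findim_hilbert \<Rightarrow> 'h) \<Rightarrow> 'h \<Rightarrow> 'h"
  where "cadjoint A = (THE B. \<forall>x y. cinner (A x) y = cinner x (B y))"

lemma cadjoint_unique:
  fixes A B :: "'h::findim_hilbert \<Rightarrow> 'h"
  assumes "\<And>x y. cinner (A x) y = cinner x (B y)"
  shows "cadjoint A = B"
  unfolding cadjoint_def
proof (rule the_equality)
  show "\<forall>x y. cinner (A x) y = cinner x (B y)" using assms by blast
next
  fix C assume "\<forall>x y. cinner (A x) y = cinner x (C y)"
  then show "C = B" using assms by (metis cinner_ext ext)
qed

lemma cinner_cadjoint_right: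
  fixes A :: "'h::findim_hilbert \<Rightarrow> 'h"
  assumes "clinear A"
  shows "cinner x (cadjoint A y) = cinner (A x) y"
proof -
  interpret Vector_Spaces.linear "scaleC :: complex \<Rightarrow> 'h \<Rightarrow> 'h" scaleC A by (rule assms)
  have "\<exists>z. \<forall>x. cinner z x = cinner y (A x)" for y
    by (rule riesz_representation) (simp_all add: add scale cinner_add_right cinner_scaleC_right)
  then obtain B where B: "\<And>x y. cinner (B y) x = cinner y (A x)" by metis
  have "cinner (A x) y = cinner x (B y)" for x y
    using B[of y x] by (metis cinner_commute)
  then show ?thesis using cadjoint_unique[of A B] by simp
qed

definition unitary_op :: "('h::findim_hilbert \<Rightarrow> 'h) \<Rightarrow> bool"
  where "unitary_op A \<longleftrightarrow> clinear A \<and> cadjoint A \<circ> A = id \<and> A \<circ> cadjoint A = id"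

lemma unitary_op_iff_surj_isometry:
  fixes A :: "'h::findim_hilbert \<Rightarrow> 'h"
  shows "unitary_op A \<longleftrightarrow> clinear A \<and> surj A \<and> (\<forall>x y. cinner (A x) (A y) = cinner x y)"
proof
  assume u: "unitary_op A"
  then have lin: "clinear A" and l: "\<And>x. cadjoint A (A x) = x" and r: "\<And>x. A (cadjoint A x) = x"
    by (auto simp: unitary_op_def fun_eq_iff)
  have "cinner (A x) (A y) = cinner x y" for x y
    using cinner_cadjoint_right[OF lin, of x "A y"] by (simp add: l)
  moreover have "surj A" using r by (metis surjI)
  ultimately show "clinear A \<and> surj A \<and> (\<forall>x y. cinner (A x) (A y) = cinner x y)"
    using lin by blast
next
  assume *: "clinear A \<and> surj A \<and> (\<forall>x y. cinner (A x) (A y) = cinner x y)"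
  then have "cadjoint A (A y) = y" for y
    by (simp add: cinner_ext cinner_cadjoint_right)
  moreover have "A (cadjoint A x) = x" for x
  proof -
    obtain y where "x = A y" using * by (meson surjE)
    with calculation show ?thesis by simp
  qed
  ultimately show "unitary_op A" using *
    by (simp add: unitary_op_def fun_eq_iff)
qed

(* The trace with respect to a fixed basis of the whole space; the next lemmas show that
   the choice of basis is irrelevant and that orthonormal bases give the familiar formula. *)
definition op_trace :: "('h::findim_hilbert \<Rightarrow> 'h) \<Rightarrow> complex"
  where "op_trace A = (let B = complex_vector.extend_basis {} in
    \<Sum>b\<in>B. complex_vector.representation B (A b) b)"

lemma op_trace_eq_basis:
  fixes A :: "'h::findim_hilbert \<Rightarrow> 'h"
  assumes A: "clinear A"
    and B: "complex_vector.independent B" "complex_vector.span B = UNIV"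
  shows "op_trace A = (\<Sum>b\<in>B. complex_vector.representation B (A b) b)"
proof -
  interpret Vector_Spaces.linear "scaleC :: complex \<Rightarrow> 'h \<Rightarrow> 'h" scaleC A by (rule A)
  define C :: "'h set" where "C = complex_vector.extend_basis {}"
  let ?R = "complex_vector.representation"
  have C: "complex_vector.independent C" "complex_vector.span C = UNIV"
    unfolding C_def
    by (simp_all add: complex_vector.independent_extend_basis complex_vector.independent_empty
        complex_vector.span_extend_basis)
  have fin: "finite B" "finite C"
    using B C finite_if_independent by auto
  have lin: "?R D (\<Sum>i\<in>I. g i *\<^sub>C v i) b = (\<Sum>i\<in>I. g i * ?R D (v i) b)"
    if "complex_vector.independent D" "complex_vector.span D = UNIV"
    for D I and g :: "'h \<Rightarrow> complex" and v and b :: 'h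
    using that by (simp add: complex_vector.representation_sum complex_vector.representation_scale)
  have expB: "x = (\<Sum>b\<in>B. ?R B x b *\<^sub>C b)" for x
    using complex_vector.sum_representation_eq[of B x B] B fin by simp
  have expC: "x = (\<Sum>c\<in>C. ?R C x c *\<^sub>C c)" for x
    using complex_vector.sum_representation_eq[of C x C] C fin by simp
  have "op_trace A = (\<Sum>c\<in>C. ?R C (A c) c)"
    by (simp add: op_trace_def C_def Let_def)
  also have "\<dots> = (\<Sum>c\<in>C. \<Sum>b\<in>B. ?R B (A c) b * ?R C b c)"
  proof (intro sum.cong refl)
    fix c
    have "?R C (A c) c = ?R C (\<Sum>b\<in>B. ?R B (A c) b *\<^sub>C b) c"
      by (rule arg_cong[where f = "\<lambda>v. ?R C v c"]) (rule expB)
    then show "?R C (A c) c = (\<Sum>b\<in>B. ?R B (A c) b * ?R C b c)"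
      by (simp only: lin[OF C])
  qed
  also have "\<dots> = (\<Sum>b\<in>B. \<Sum>c\<in>C. ?R C b c * ?R B (A c) b)"
    by (subst sum.swap) (simp add: mult.commute)
  also have "\<dots> = (\<Sum>b\<in>B. ?R B (A b) b)"
  proof (intro sum.cong refl)
    fix b
    have "A b = A (\<Sum>c\<in>C. ?R C b c *\<^sub>C c)"
      by (rule arg_cong[where f = A]) (rule expC)
    also have "\<dots> = (\<Sum>c\<in>C. ?R C b c *\<^sub>C A c)"
      by (simp add: sum scale)
    finally show "(\<Sum>c\<in>C. ?R C b c * ?R B (A c) b) = ?R B (A b) b"
      by (simp only: lin[OF B])
  qed
  finally show ?thesis .
qed

lemma op_trace_eq_orthonormal_basis:
  fixes A :: "'h::findim_hilbert \<Rightarrow> 'h"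
  assumes A: "clinear A"
    and B: "complex_vector.independent B" "complex_vector.span B = UNIV"
    and orth: "\<And>b c. b \<in> B \<Longrightarrow> c \<in> B \<Longrightarrow> cinner b c = (if b = c then 1 else 0)"
  shows "op_trace A = (\<Sum>b\<in>B. cinner b (A b))"
proof -
  have fin: "finite B" using B finite_if_independent by auto
  have "complex_vector.representation B x b = cinner b x" if b: "b \<in> B" for b x
  proof -
    let ?r = "complex_vector.representation B x"
    have "x = (\<Sum>c\<in>B. ?r c *\<^sub>C c)"
      using complex_vector.sum_representation_eq[of B x B] B fin by simp
    then have "cinner b x = cinner b (\<Sum>c\<in>B. ?r c *\<^sub>C c)"
      by (rule arg_cong)
    also have "\<dots> = (\<Sum>c\<in>B. ?r c * (if b = c then 1 else 0))"
      using b orth by (simp add: cinner_sum_right cinner_scaleC_right)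
    also have "\<dots> = ?r b" using b fin by (simp add: if_distrib sum.delta cong: if_cong)
    finally show ?thesis by simp
  qed
  then show ?thesis using op_trace_eq_basis[OF A B] by simp
qed

definition unitary_basis :: "'x set \<Rightarrow> ('x \<Rightarrow> 'h::findim_hilbert \<Rightarrow> 'h) \<Rightarrow> bool"
  where "unitary_basis X U \<longleftrightarrow>
    finite X \<and> card X = (complex_vector.dim (UNIV :: 'h set))\<^sup>2 \<and>
    (\<forall>x\<in>X. unitary_op (U x)) \<and>
    (\<forall>x\<in>X. \<forall>y\<in>X. op_trace (cadjoint (U x) \<circ> U y) =
      (if x = y then of_nat (complex_vector.dim (UNIV :: 'h set)) else 0))"

definition unitary_bases_equivalent ::
    "'x set \<Rightarrow> ('x \<Rightarrow> 'h::findim_hilbert \<Rightarrow> 'h) \<Rightarrow> ('x \<Rightarrow> 'h \<Rightarrow> 'h) \<Rightarrow> bool"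
  where "unitary_bases_equivalent X U U' \<longleftrightarrow>
    (\<exists>V1 V2 \<pi>. unitary_op V1 \<and> unitary_op V2 \<and> bij_betw \<pi> X X \<and>
      (\<forall>x\<in>X. U' (\<pi> x) = V1 \<circ> U x \<circ> V2))"

definition associated_tag ::
    "'x set \<Rightarrow> ('x \<Rightarrow> 'h::findim_hilbert \<Rightarrow> 'h) \<Rightarrow> 'x \<times> ('h \<Rightarrow> 'h) \<times> ('h \<Rightarrow> 'h) set \<Rightarrow> bool"
  where "associated_tag X U T \<longleftrightarrow>
    (\<exists>x0\<in>X. T = (x0, U x0, {cadjoint (U x0) \<circ> U x |x. x \<in> X \<and> x \<noteq> x0}))"

definition collectively_unitarily_equivalent ::
    "('h::findim_hilbert \<Rightarrow> 'h) set \<Rightarrow> ('h \<Rightarrow> 'h) set \<Rightarrow> bool"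
  where "collectively_unitarily_equivalent F G \<longleftrightarrow>
    (\<exists>V. unitary_op V \<and> G = {cadjoint V \<circ> A \<circ> V |A. A \<in> F})"

end

(* A tag of U at x0, completed by the identity, is the family U_{x0}^* U_x over all x in X.
   If U'_{x'} = V1 U_x V2, the factor V1 cancels in these products, so V2 conjugates the two
   tags. Conversely, if V conjugates the tags, then V1 = U'_{x0'} V^* U_{x0}^* and V2 = V carry
   the set of all U_x onto the set of all U'_x, and the bijection of X exists because the
   members of a unitary basis are pairwise distinct. *)
theory Submission
  imports Defs
begin

lemma unitary_op_cadjoint_comp [simp]: "unitary_op A \<Longrightarrow> cadjoint A (A x) = x"
  and unitary_op_comp_cadjoint [simp]: "unitary_op A \<Longrightarrow> A (cadjoint A x) = x"
  by (auto simp: unitary_op_def fun_eq_iff)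

text \<open>The description as a surjective isometry passes to compositions without computing the
  adjoint of a product.\<close>

lemma unitary_op_comp: "unitary_op A \<Longrightarrow> unitary_op B \<Longrightarrow> unitary_op (A \<circ> B)"
  unfolding unitary_op_iff_surj_isometry
  using Vector_Spaces.linear_compose[of scaleC scaleC B scaleC A] comp_surj[of B A] by simp

text \<open>Tested against an arbitrary \<open>z\<close>, the value
  \<open>cinner z (cadjoint A y)\<close> equals \<open>cinner (A z) y\<close>, which is linear in
  \<open>y\<close>.\<close>

lemma clinear_cadjoint:
  assumes "clinear (A :: 'h::findim_hilbert \<Rightarrow> 'h)"
  shows "clinear (cadjoint A)"
  by unfold_locales
    (rule cinner_ext,
      simp add: cinner_cadjoint_right[OF assms] cinner_add_right cinner_scaleC_right)+

lemma cadjoint_cadjoint: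
  assumes "clinear (A :: 'h::findim_hilbert \<Rightarrow> 'h)"
  shows "cadjoint (cadjoint A) = A"
  by (rule cadjoint_unique) (metis assms cinner_cadjoint_right cinner_commute)

lemma cadjoint_comp:
  assumes "clinear (A :: 'h::findim_hilbert \<Rightarrow> 'h)" and "clinear B"
  shows "cadjoint (A \<circ> B) = cadjoint B \<circ> cadjoint A"
  by (rule cadjoint_unique) (simp add: assms cinner_cadjoint_right)

lemma unitary_op_cadjoint: "unitary_op A \<Longrightarrow> unitary_op (cadjoint A)"
  by (simp add: unitary_op_def clinear_cadjoint cadjoint_cadjoint)

text \<open>If two distinct indices carried the same operator, one trace would be both the nonzero
  dimension and 0.\<close>

lemma unitary_basis_inj_on:
  fixes U :: "'x \<Rightarrow> 'h::findim_hilbert \<Rightarrow> 'h"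
  assumes "unitary_basis X U" and "complex_vector.dim (UNIV :: 'h set) \<noteq> 0"
  shows "inj_on U X"
proof (rule inj_onI, rule ccontr)
  fix x y assume "x \<in> X" "y \<in> X" "U x = U y" "x \<noteq> y"
  with assms have "op_trace (cadjoint (U x) \<circ> U x) = of_nat (complex_vector.dim (UNIV :: 'h set))"
    and "op_trace (cadjoint (U x) \<circ> U x) = 0"
    unfolding unitary_basis_def by (simp, metis)
  with assms(2) show False by simp
qed

lemma collectively_unitarily_equivalent_tags_if_bases_equivalent:
  assumes U: "\<And>x. x \<in> X \<Longrightarrow> unitary_op (U x)"
    and V: "unitary_op V1" "unitary_op V2" and \<pi>: "bij_betw \<pi> X X"
    and eq: "\<And>x. x \<in> X \<Longrightarrow> U' (\<pi> x) = V1 \<circ> U x \<circ> V2" and x0: "x0 \<in> X"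
  shows "collectively_unitarily_equivalent
    {cadjoint (U x0) \<circ> U x |x. x \<in> X \<and> x \<noteq> x0}
    {cadjoint (U' (\<pi> x0)) \<circ> U' x |x. x \<in> X \<and> x \<noteq> \<pi> x0}"
proof -
  have W: "cadjoint (U' (\<pi> x0)) \<circ> U' (\<pi> x) = cadjoint V2 \<circ> (cadjoint (U x0) \<circ> U x) \<circ> V2"
    if "x \<in> X" for x
  proof -
    \<comment> \<open>The adjoint reverses the product, so \<open>cadjoint V1\<close> ends up next
      to the \<open>V1\<close> of \<open>U' (\<pi> x)\<close> and cancels.\<close>
    have "cadjoint (U' (\<pi> x0)) = cadjoint V2 \<circ> cadjoint (U x0) \<circ> cadjoint V1"
      using U[OF x0] V unitary_op_comp[OF V(1) U[OF x0]]
      by (simp add: eq x0 cadjoint_comp unitary_op_def o_assoc)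
    then show ?thesis using V by (simp add: eq that fun_eq_iff)
  qed
  \<comment> \<open>Injectivity of \<open>\<pi>\<close> matches the two omitted indices, so the
    pointwise identity becomes an equality of the sets.\<close>
  have "X - {\<pi> x0} = \<pi> ` (X - {x0})"
    using \<pi> x0 by (auto simp: bij_betw_def inj_on_def)
  then have "(\<lambda>x. cadjoint (U' (\<pi> x0)) \<circ> U' x) ` (X - {\<pi> x0}) =
      (\<lambda>A. cadjoint V2 \<circ> A \<circ> V2) ` (\<lambda>x. cadjoint (U x0) \<circ> U x) ` (X - {x0})"
    using W by (simp add: image_image)
  then show ?thesis
    unfolding collectively_unitarily_equivalent_def
    using V(2) by (intro exI[of _ V2]) (simp add: image_def set_eq_iff Bex_def conj_ac)
qed

text \<open>The omitted index \<open>x0\<close> contributes exactly the identity. Restoring it turns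
  the tag into an image of all of \<open>X\<close>, free of the side condition on
  \<open>x0\<close>.\<close>

lemma insert_id_tag:
  assumes "unitary_op (U x0)" and "x0 \<in> X"
  shows "insert id {cadjoint (U x0) \<circ> U x |x. x \<in> X \<and> x \<noteq> x0} = (\<lambda>x. cadjoint (U x0) \<circ> U x) ` X"
proof -
  have "cadjoint (U x0) \<circ> U x0 = id" using assms(1) by (simp add: unitary_op_def)
  then show ?thesis using assms(2) by (auto simp: image_iff) metis
qed

lemma bases_equivalent_if_collectively_unitarily_equivalent_tags:
  assumes U: "\<And>x. x \<in> X \<Longrightarrow> unitary_op (U x)" "inj_on U X"
    and U': "\<And>x. x \<in> X \<Longrightarrow> unitary_op (U' x)" "inj_on U' X"
    and x0: "x0 \<in> X" "x0' \<in> X"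
    and W: "collectively_unitarily_equivalent
      {cadjoint (U x0) \<circ> U x |x. x \<in> X \<and> x \<noteq> x0}
      {cadjoint (U' x0') \<circ> U' x |x. x \<in> X \<and> x \<noteq> x0'}"
      (is "collectively_unitarily_equivalent ?W ?W'")
  shows "unitary_bases_equivalent X U U'"
proof -
  obtain V where V: "unitary_op V" and eq: "?W' = {cadjoint V \<circ> A \<circ> V |A. A \<in> ?W}"
    using W unfolding collectively_unitarily_equivalent_def by blast
  \<comment> \<open>Conjugation by \<open>V\<close> fixes the identity, so the relation between the
    tags extends to the completed tags.\<close>
  have "cadjoint V \<circ> id \<circ> V = id" using V by (simp add: unitary_op_def)
  then have "insert id ?W' = (\<lambda>A. cadjoint V \<circ> A \<circ> V) ` insert id ?W"
    unfolding eq image_insert by (simp add: image_def Bex_def conj_commute)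
  then have tags: "(\<lambda>x. cadjoint (U' x0') \<circ> U' x) ` X =
      (\<lambda>x. cadjoint V \<circ> (cadjoint (U x0) \<circ> U x) \<circ> V) ` X"
    using insert_id_tag[of U x0 X] insert_id_tag[of U' x0' X] U(1) U'(1) x0
    by (simp add: image_image)
  \<comment> \<open>This is the left factor that results from solving \<open>cadjoint (U' x0')
    \<circ> U' y = cadjoint V \<circ> (cadjoint (U x0) \<circ> U x) \<circ> V\<close> for
    \<open>U' y\<close>.\<close>
  define V1 where "V1 = U' x0' \<circ> cadjoint V \<circ> cadjoint (U x0)"
  have V1: "unitary_op V1"
    unfolding V1_def using V U(1) U'(1) x0 by (intro unitary_op_comp unitary_op_cadjoint)
  define f where "f = (\<lambda>x. V1 \<circ> U x \<circ> V)"
  \<comment> \<open>Multiplying the completed tag on the left by \<open>U' x0'\<close> recovers the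
    basis itself.\<close>
  have "U' ` X = (\<lambda>A. U' x0' \<circ> A) ` (\<lambda>x. cadjoint (U' x0') \<circ> U' x) ` X"
    using U'(1)[OF x0(2)] by (simp add: image_image comp_def)
  also have "\<dots> = f ` X"
    unfolding tags by (simp add: image_image f_def V1_def comp_assoc)
  finally have img: "U' ` X = f ` X" .
  have "inj_on f X"
  proof (rule inj_onI)
    fix x y assume xy: "x \<in> X" "y \<in> X" and f: "f x = f y"
    \<comment> \<open>Since \<open>U z\<close> can be recovered from \<open>f z\<close>,
      distinctness of the \<open>U x\<close> passes to \<open>f\<close>.\<close>
    have "cadjoint V1 \<circ> f z \<circ> cadjoint V = U z" for z
      using V V1 by (simp add: f_def fun_eq_iff)
    then have "U x = U y" using f by metis
    with xy show "x = y" using U(2) by (simp add: inj_on_eq_iff)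
  qed
  \<comment> \<open>Both \<open>f\<close> and \<open>U'\<close> are injective on \<open>X\<close>
    with the same image, so sending \<open>x\<close> to the index at which \<open>U'\<close> takes
    the value \<open>f x\<close> permutes \<open>X\<close>.\<close>
  then have "bij_betw (inv_into X U' \<circ> f) X X"
    using img U'(2) by (metis bij_betw_trans bij_betw_inv_into bij_betw_imageI)
  moreover have "U' ((inv_into X U' \<circ> f) x) = V1 \<circ> U x \<circ> V" if "x \<in> X" for x
  proof -
    have "f x \<in> U' ` X" using img that by simp
    then show ?thesis by (simp add: f_inv_into_f f_def)
  qed
  ultimately show ?thesis
    unfolding unitary_bases_equivalent_def using V V1 by blast
qed

theorem theorem4p2p3:
  fixes X :: "'x set" and U U' :: "'x \<Rightarrow> 'h::findim_hilbert \<Rightarrow> 'h"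
  assumes "complex_vector.dim (UNIV :: 'h set) \<ge> 2"
    and "unitary_basis X U" and "unitary_basis X U'"
  shows "(unitary_bases_equivalent X U U' \<longleftrightarrow>
      (\<exists>x0 W x0' W'. associated_tag X U (x0, U x0, W) \<and> associated_tag X U' (x0', U' x0', W') \<and>
        collectively_unitarily_equivalent W W')) \<and>
    (unitary_bases_equivalent X U U' \<longleftrightarrow>
      (\<forall>x0 W. associated_tag X U (x0, U x0, W) \<longrightarrow>
        (\<exists>x0' W'. associated_tag X U' (x0', U' x0', W') \<and>
          collectively_unitarily_equivalent W W')))"
    (is "(?i \<longleftrightarrow> ?ii) \<and> (?i \<longleftrightarrow> ?iii)")
proof -
  have inj: "inj_on U X" "inj_on U' X"
    using unitary_basis_inj_on assms by fastforce+
  have unitary: "unitary_op (U x)" "unitary_op (U' x)" if "x \<in> X" for x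
    using assms(2,3) that by (auto simp: unitary_basis_def)
  \<comment> \<open>This keeps (iii) from being vacuous: it supplies a tag of \<open>U\<close> from
    which (ii) follows. The cycle proved is (i) to (iii) to (ii) to (i).\<close>
  have "X \<noteq> {}" using assms(1,2) by (auto simp: unitary_basis_def)
  have "?iii" if equiv: "?i"
  proof (intro allI impI)
    fix x0 W assume tag: "associated_tag X U (x0, U x0, W)"
    obtain V1 V2 \<pi> where \<pi>: "unitary_op V1" "unitary_op V2" "bij_betw \<pi> X X"
      "\<And>x. x \<in> X \<Longrightarrow> U' (\<pi> x) = V1 \<circ> U x \<circ> V2"
      using equiv unfolding unitary_bases_equivalent_def by blast
    have x0: "x0 \<in> X" and W: "W = {cadjoint (U x0) \<circ> U x |x. x \<in> X \<and> x \<noteq> x0}"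
      using tag by (auto simp: associated_tag_def)
    have "\<pi> x0 \<in> X" using \<pi>(3) x0 by (auto simp: bij_betw_def)
    then show "\<exists>x0' W'. associated_tag X U' (x0', U' x0', W') \<and>
        collectively_unitarily_equivalent W W'"
      using collectively_unitarily_equivalent_tags_if_bases_equivalent
        [of X U V1 V2 \<pi> U', OF unitary(1) \<pi> x0]
      unfolding W associated_tag_def by blast
  qed
  moreover have "?ii" if "?iii"
  proof -
    obtain x0 where "x0 \<in> X" using \<open>X \<noteq> {}\<close> by blast
    then have "associated_tag X U (x0, U x0, {cadjoint (U x0) \<circ> U x |x. x \<in> X \<and> x \<noteq> x0})"
      by (auto simp: associated_tag_def)
    with that show ?thesis by blast
  qed
  moreover have "?i" if "?ii"
    using that bases_equivalent_if_collectively_unitarily_equivalent_tags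
      [OF unitary(1) inj(1) unitary(2) inj(2)]
    unfolding associated_tag_def by auto
  ultimately show ?thesis by blast
qed

end
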